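(* Let $H$ be a finite hypergraph (multiple edges allowed) without edges of size $0$ or $1$. Then there are weightings $\rho: E(H)\to \{1,2,3\}$ and $\rho': V(H)\to \{1,2\}$ such that the induced total vertex weights $w(v):=\rho'(v)+\sum_{e\in E(H),\, e\ni v}\rho(e)$, $v\in V(H)$, properly color $V(H)$.
   Context: A hypergraph $H$ consists of a vertex set $V(H)$ and a collection $E(H)$ of subsets of $V(H)$, called edges; multiple edges are allowed, i.e. $E(H)$ may contain the same subset several times (each copy is a separate edge with its own weight, and sums over edges count copies separately). Edges need not have the same size. A function on $V(H)$ properly colors $V(H)$ if no edge is monochromatic, i.e. every edge contains at least two vertices with different values. *)

theory Defs
  imports Main "HOL-Library.FuncSet"
begin

text \<open>Multiple edges are modelled by an incidence function: \<open>E\<close> is a set of edge names, and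
  \<open>ends e\<close> is the vertex set of the edge named \<open>e\<close>. As \<open>ends\<close> need not be injective, the same
  subset of \<open>V\<close> may occur under several names, each carrying its own weight.\<close>

locale hypergraph =
  fixes V :: "'v set" and E :: "'e set" and ends :: "'e \<Rightarrow> 'v set"
  assumes ends_subset: "e \<in> E \<Longrightarrow> ends e \<subseteq> V"

locale finite_hypergraph = hypergraph +
  assumes finite_vertices: "finite V"
    and finite_edges: "finite E"

definition properly_colors :: "'e set \<Rightarrow> ('e \<Rightarrow> 'v set) \<Rightarrow> ('v \<Rightarrow> 'c) \<Rightarrow> bool" where
  "properly_colors E ends c \<longleftrightarrow> (\<forall>e\<in>E. \<exists>x\<in>ends e. \<exists>y\<in>ends e. c x \<noteq> c y)"

definition total_weight ::
  "'e set \<Rightarrow> ('e \<Rightarrow> 'v set) \<Rightarrow> ('e \<Rightarrow> nat) \<Rightarrow> ('v \<Rightarrow> nat) \<Rightarrow> 'v \<Rightarrow> nat" where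
  "total_weight E ends \<rho> \<rho>' v = \<rho>' v + (\<Sum>e | e \<in> E \<and> v \<in> ends e. \<rho> e)"

end

theory Submission
  imports Defs
begin

text \<open>Kalkowski's algorithm. Start with weight 2 on every edge and weight 1 on every vertex, and
  process the vertices one at a time, keeping the total weights of processed vertices fixed. When
  \<open>v\<close> is processed, consider the processed vertices \<open>p\<close> for which some edge through \<open>v\<close> has \<open>p\<close> as
  its only processed vertex, and select one such edge for each \<open>p\<close>. The weight of the selected edge
  is still 2, so it can be changed by 1 while the change at \<open>p\<close> is absorbed by switching the vertex
  weight of \<open>p\<close> between 1 and 2. With \<open>d\<close> such vertices \<open>p\<close> this offers at least \<open>d + 1\<close> total
  weights for \<open>v\<close>, one of which differs from the total weights of all these \<open>p\<close>. Every edge thus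
  becomes properly colored as soon as its second vertex is processed.\<close>

text \<open>The shift takes the maximum of \<open>X\<close> (for positive \<open>s\<close>) or its
  minimum (for negative \<open>s\<close>) out of \<open>X\<close>.\<close>

lemma card_less_card_Un_translate:
  fixes X :: "int set"
  assumes "finite X" "X \<noteq> {}" "s \<noteq> 0"
  shows "card X < card (X \<union> (\<lambda>x. x + s) ` X)"
proof -
  have "\<exists>x\<in>X. x + s \<notin> X"
  proof (cases "s > 0")
    case True
    then have "Max X + s \<notin> X" using Max_ge[OF assms(1), of "Max X + s"] by auto
    then show ?thesis using Max_in assms by blast
  next
    case False
    then have "Min X + s \<notin> X" using Min_le[OF assms(1), of "Min X + s"] assms(3) by auto
    then show ?thesis using Min_in assms by blast
  qed
  then have "X \<subset> X \<union> (\<lambda>x. x + s) ` X" by blast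
  then show ?thesis using assms(1) by (intro psubset_card_mono) auto
qed

text \<open>Allowing one more summand \<open>x\<close> joins the set of sums with its translate by
  \<open>\<sigma> x\<close>, so each element of \<open>P\<close> contributes a new sum besides the
  empty one.\<close>

lemma card_less_card_subset_sums:
  fixes \<sigma> :: "'a \<Rightarrow> int"
  assumes "finite P" "\<forall>p\<in>P. \<sigma> p \<noteq> 0"
  shows "card P < card (sum \<sigma> ` Pow P)"
  using assms
proof (induction P rule: finite_induct)
  case empty
  then show ?case by simp
next
  case (insert x P)
  let ?X = "sum \<sigma> ` Pow P"
  have "sum \<sigma> (insert x A) = sum \<sigma> A + \<sigma> x" if "A \<subseteq> P" for A
    using that insert.hyps by (subst sum.insert) (auto dest: finite_subset)
  then have "sum \<sigma> ` Pow (insert x P) = ?X \<union> (\<lambda>y. y + \<sigma> x) ` ?X"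
    unfolding Pow_insert image_Un image_image by (intro arg_cong2[of _ _ _ _ "(\<union>)"] image_cong) auto
  moreover have "card ?X < card (?X \<union> (\<lambda>y. y + \<sigma> x) ` ?X)"
    using insert by (intro card_less_card_Un_translate) auto
  ultimately show ?case using insert by simp
qed

text \<open>Pigeonhole: there are more subset sums than values to avoid. In the algorithm,
  \<open>k\<close> is the current total weight of the vertex being processed.\<close>

lemma subset_sum_avoiding:
  fixes \<sigma> w :: "'a \<Rightarrow> int"
  assumes "finite P" "\<forall>p\<in>P. \<sigma> p \<noteq> 0"
  obtains A where "A \<subseteq> P" "k + sum \<sigma> A \<notin> w ` P"
proof -
  have "card ((\<lambda>p. w p - k) ` P) < card (sum \<sigma> ` Pow P)"
    using card_less_card_subset_sums[OF assms] card_image_le[OF assms(1)] by (rule le_less_trans[rotated])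
  then have "\<not> sum \<sigma> ` Pow P \<subseteq> (\<lambda>p. w p - k) ` P"
    using card_mono[of "(\<lambda>p. w p - k) ` P" "sum \<sigma> ` Pow P"] assms(1) by auto
  then obtain A where "A \<subseteq> P" "sum \<sigma> A \<notin> (\<lambda>p. w p - k) ` P" by blast
  moreover from this(2) have "k + sum \<sigma> A \<notin> w ` P" by force
  ultimately show thesis using that by blast
qed

text \<open>Total weights over the integers, so that signed modifications of a weighting are additive.\<close>

definition int_weight ::
  "'e set \<Rightarrow> ('e \<Rightarrow> 'v set) \<Rightarrow> ('e \<Rightarrow> int) \<Rightarrow> ('v \<Rightarrow> int) \<Rightarrow> 'v \<Rightarrow> int" where
  "int_weight E ends \<rho> \<rho>' v = \<rho>' v + (\<Sum>e | e \<in> E \<and> v \<in> ends e. \<rho> e)"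

lemma int_weight_add_selected:
  assumes "finite E" "finite A" "g ` A \<subseteq> E"
  shows "int_weight E ends (\<lambda>e. \<rho> e + (\<Sum>p\<in>A. if g p = e then \<sigma> p else 0)) \<rho>' u
    = int_weight E ends \<rho> \<rho>' u + (\<Sum>p\<in>A. if u \<in> ends (g p) then \<sigma> p else 0)"
proof -
  have "(\<Sum>e | e \<in> E \<and> u \<in> ends e. \<Sum>p\<in>A. if g p = e then \<sigma> p else 0)
      = (\<Sum>p\<in>A. \<Sum>e | e \<in> E \<and> u \<in> ends e. if g p = e then \<sigma> p else 0)"
    by (rule sum.swap)
  also have "\<dots> = (\<Sum>p\<in>A. if u \<in> ends (g p) then \<sigma> p else 0)"
    using assms by (intro sum.cong) (auto simp: sum.delta)
  finally show ?thesis by (simp add: int_weight_def sum.distrib)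
qed

text \<open>Invariant of the algorithm, with \<open>S\<close> the set of processed vertices. An edge
  with at most one vertex in \<open>S\<close> still has weight 2 and can move by 1 either way; an
  edge with two is already settled by vertices in \<open>S\<close>.\<close>

definition weighting_up_to ::
  "'e set \<Rightarrow> ('e \<Rightarrow> 'v set) \<Rightarrow> 'v set \<Rightarrow> ('e \<Rightarrow> int) \<Rightarrow> ('v \<Rightarrow> int) \<Rightarrow> bool" where
  "weighting_up_to E ends S \<rho> \<rho>' \<longleftrightarrow>
     range \<rho> \<subseteq> {1, 2, 3} \<and> range \<rho>' \<subseteq> {1, 2} \<and>
     (\<forall>e\<in>E. (\<forall>x\<in>ends e \<inter> S. \<forall>y\<in>ends e \<inter> S. x = y) \<longrightarrow> \<rho> e = 2) \<and>
     (\<forall>e\<in>E. (\<exists>x\<in>ends e \<inter> S. \<exists>y\<in>ends e \<inter> S. x \<noteq> y) \<longrightarrow>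
       (\<exists>x\<in>ends e \<inter> S. \<exists>y\<in>ends e \<inter> S. int_weight E ends \<rho> \<rho>' x \<noteq> int_weight E ends \<rho> \<rho>' y))"

lemma weighting_up_to_insert:
  assumes "finite E" "finite S" "v \<notin> S" and \<rho>: "weighting_up_to E ends S \<rho> \<rho>'"
  obtains \<tau> \<tau>' where "weighting_up_to E ends (insert v S) \<tau> \<tau>'"
proof -
  let ?w = "int_weight E ends \<rho> \<rho>'"
  define P where "P = {p \<in> S. \<exists>e\<in>E. v \<in> ends e \<and> ends e \<inter> S = {p}}"
  have "\<forall>p\<in>P. \<exists>e. e \<in> E \<and> v \<in> ends e \<and> ends e \<inter> S = {p}" unfolding P_def by blast
  then obtain g where g: "\<And>p. p \<in> P \<Longrightarrow> g p \<in> E \<and> v \<in> ends (g p) \<and> ends (g p) \<inter> S = {p}"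
    by metis
  \<comment> \<open>The sign is chosen so that \<open>\<rho>' p - \<sigma> p\<close> is the other
    element of \<open>{1, 2}\<close>.\<close>
  define \<sigma> :: "_ \<Rightarrow> int" where "\<sigma> p = (if \<rho>' p = 1 then -1 else 1)" for p
  have finP: "finite P" using assms(2) unfolding P_def by simp
  have "\<forall>p\<in>P. \<sigma> p \<noteq> 0" by (simp add: \<sigma>_def)
  then obtain A where A: "A \<subseteq> P" "?w v + sum \<sigma> A \<notin> ?w ` P"
    by (rule subset_sum_avoiding[OF finP])
  have finA: "finite A" using A finP finite_subset by blast
  have gA: "g ` A \<subseteq> E" using A g by auto
  define \<delta> where "\<delta> e = (\<Sum>p\<in>A. if g p = e then \<sigma> p else 0)" for e
  \<comment> \<open>The selected edge determines \<open>p\<close> as its only vertex in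
    \<open>S\<close>, so no edge is changed twice.\<close>
  have inj: "g p = g q \<longleftrightarrow> p = q" if "p \<in> A" "q \<in> A" for p q
    using that A(1) g by (metis singleton_inject subsetD)
  have \<delta>_g: "\<delta> (g q) = \<sigma> q" if "q \<in> A" for q
  proof -
    have "\<delta> (g q) = (\<Sum>p\<in>A. if p = q then \<sigma> p else 0)"
      unfolding \<delta>_def using that inj by (intro sum.cong) simp_all
    then show ?thesis using that finA by simp
  qed
  have \<delta>_0: "\<delta> e = 0" if "e \<notin> g ` A" for e
    unfolding \<delta>_def using that by (intro sum.neutral) auto
  define \<tau> where "\<tau> e = \<rho> e + \<delta> e" for e
  define \<tau>' where "\<tau>' p = (if p \<in> A then \<rho>' p - \<sigma> p else \<rho>' p)" for p
  let ?w' = "int_weight E ends \<tau> \<tau>'"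
  have w': "?w' u = ?w u + (\<tau>' u - \<rho>' u) + (\<Sum>p\<in>A. if u \<in> ends (g p) then \<sigma> p else 0)" for u
    using int_weight_add_selected[OF assms(1) finA gA, of ends \<rho> \<sigma> \<tau>' u]
    unfolding \<tau>_def \<delta>_def by (simp add: int_weight_def)
  \<comment> \<open>At \<open>u\<close> in \<open>S\<close> only the edge selected for
    \<open>u\<close> itself can count, and its change cancels against the switch of the vertex
    weight.\<close>
  have w'_S: "?w' u = ?w u" if "u \<in> S" for u
  proof -
    have "(\<Sum>p\<in>A. if u \<in> ends (g p) then \<sigma> p else 0) = (\<Sum>p\<in>A. if p = u then \<sigma> p else 0)"
    proof (rule sum.cong)
      fix p assume "p \<in> A"
      then have "ends (g p) \<inter> S = {p}" using A g by blast
      then have "u \<in> ends (g p) \<longleftrightarrow> p = u" using that by (metis IntD1 IntI singletonD singletonI)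
      then show "(if u \<in> ends (g p) then \<sigma> p else 0) = (if p = u then \<sigma> p else 0)" by simp
    qed simp
    then show ?thesis using w'[of u] finA by (simp add: \<tau>'_def)
  qed
  \<comment> \<open>All selected edges pass through \<open>v\<close>, whose own vertex weight stays
    put because \<open>A\<close> lies in \<open>S\<close>.\<close>
  have w'_v: "?w' v = ?w v + sum \<sigma> A"
  proof -
    have "(\<Sum>p\<in>A. if v \<in> ends (g p) then \<sigma> p else 0) = sum \<sigma> A"
      using A g by (intro sum.cong) auto
    moreover have "v \<notin> A" using A assms(3) unfolding P_def by blast
    ultimately show ?thesis using w'[of v] by (simp add: \<tau>'_def)
  qed
  have old:
    "range \<rho> \<subseteq> {1, 2, 3}" "range \<rho>' \<subseteq> {1, 2}"
    "\<And>e. e \<in> E \<Longrightarrow> \<forall>x\<in>ends e \<inter> S. \<forall>y\<in>ends e \<inter> S. x = y \<Longrightarrow> \<rho> e = 2"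
    "\<And>e. e \<in> E \<Longrightarrow> \<exists>x\<in>ends e \<inter> S. \<exists>y\<in>ends e \<inter> S. x \<noteq> y \<Longrightarrow>
       \<exists>x\<in>ends e \<inter> S. \<exists>y\<in>ends e \<inter> S. ?w x \<noteq> ?w y"
    using \<rho> unfolding weighting_up_to_def by simp_all
  have \<tau>_g: "\<tau> (g p) = 2 + \<sigma> p" if "p \<in> A" for p
  proof -
    have "g p \<in> E" "ends (g p) \<inter> S = {p}" using that A g by blast+
    then have "\<rho> (g p) = 2" by (intro old(3)) auto
    then show ?thesis using \<delta>_g[OF that] by (simp add: \<tau>_def)
  qed
  have "weighting_up_to E ends (insert v S) \<tau> \<tau>'"
    unfolding weighting_up_to_def
  proof (intro conjI ballI impI)
    show "range \<tau> \<subseteq> {1, 2, 3}"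
    proof (rule image_subsetI)
      fix e
      show "\<tau> e \<in> {1, 2, 3}"
      proof (cases "e \<in> g ` A")
        case True
        then show ?thesis using \<tau>_g by (auto simp: \<sigma>_def split: if_splits)
      next
        case False
        then show ?thesis using \<delta>_0 image_subset_iff[THEN iffD1, OF old(1)] by (simp add: \<tau>_def)
      qed
    qed
    show "range \<tau>' \<subseteq> {1, 2}"
    proof (rule image_subsetI)
      fix p
      have "\<rho>' p \<in> {1, 2}" using old(2) by blast
      then show "\<tau>' p \<in> {1, 2}" by (auto simp: \<tau>'_def \<sigma>_def split: if_splits)
    qed
  next
    fix e assume e: "e \<in> E" "\<forall>x\<in>ends e \<inter> insert v S. \<forall>y\<in>ends e \<inter> insert v S. x = y"
    \<comment> \<open>A selected edge now has two processed vertices, \<open>v\<close> and its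
      \<open>p\<close>.\<close>
    have "e \<notin> g ` A"
    proof
      assume "e \<in> g ` A"
      then obtain p where "p \<in> P" "e = g p" using A by blast
      then have "v \<in> ends e" "ends e \<inter> S = {p}" using g by blast+
      then have "v \<in> ends e" "p \<in> ends e" "p \<in> S" by blast+
      then show False using e(2) assms(3) by (metis IntI insertCI)
    qed
    moreover have "\<rho> e = 2" using e by (intro old(3)) auto
    ultimately show "\<tau> e = 2" using \<delta>_0 by (simp add: \<tau>_def)
  next
    fix e
    assume e: "e \<in> E" "\<exists>x\<in>ends e \<inter> insert v S. \<exists>y\<in>ends e \<inter> insert v S. x \<noteq> y"
    show "\<exists>x\<in>ends e \<inter> insert v S. \<exists>y\<in>ends e \<inter> insert v S. ?w' x \<noteq> ?w' y"
    \<comment> \<open>Either \<open>e\<close> was settled before and the weights on \<open>S\<close>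
      are unchanged, or \<open>v\<close> is its second processed vertex and the choice of
      \<open>A\<close> separates \<open>v\<close> from the first.\<close>
    proof (cases "\<exists>x\<in>ends e \<inter> S. \<exists>y\<in>ends e \<inter> S. x \<noteq> y")
      case True
      then obtain x y where "x \<in> ends e \<inter> S" "y \<in> ends e \<inter> S" "?w x \<noteq> ?w y"
        using old(4)[OF e(1)] by blast
      then show ?thesis using w'_S by (intro bexI[of _ x] bexI[of _ y]) auto
    next
      case False
      then obtain p where p: "p \<in> S" "v \<in> ends e" "ends e \<inter> S = {p}" using e(2) by blast
      then have "p \<in> P" using e(1) unfolding P_def by blast
      then have "?w' v \<noteq> ?w' p" using A w'_v w'_S[OF p(1)] by auto
      then show ?thesis using p by blast
    qed
  qed
  then show thesis using that by blast
qed

lemma weighting_up_to_exists: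
  assumes "finite E" "finite S"
  shows "\<exists>\<rho> \<rho>'. weighting_up_to E ends S \<rho> \<rho>'"
  using assms(2)
proof (induction S rule: finite_induct)
  case empty
  have "weighting_up_to E ends {} (\<lambda>_. 2) (\<lambda>_. 1)" unfolding weighting_up_to_def by auto
  then show ?case by blast
next
  case (insert v S)
  then obtain \<rho> \<rho>' where "weighting_up_to E ends S \<rho> \<rho>'" by blast
  from weighting_up_to_insert[OF assms(1) insert.hyps this] show ?case by blast
qed

theorem theorem9:
  fixes V :: "'v set" and E :: "'e set" and ends :: "'e \<Rightarrow> 'v set"
  assumes "finite_hypergraph V E ends"
    and "\<forall>e\<in>E. card (ends e) \<noteq> 0 \<and> card (ends e) \<noteq> 1"
  shows "\<exists>\<rho> \<in> E \<rightarrow> {1, 2, 3}. \<exists>\<rho>' \<in> V \<rightarrow> {1, 2}.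
           properly_colors E ends (total_weight E ends \<rho> \<rho>')"
proof -
  interpret finite_hypergraph V E ends by (rule assms(1))
  \<comment> \<open>Once all of \<open>V\<close> is processed, every edge has two processed vertices
    and is therefore settled.\<close>
  obtain \<rho> \<rho>' where "weighting_up_to E ends V \<rho> \<rho>'"
    using weighting_up_to_exists[OF finite_edges finite_vertices] by blast
  then have range: "range \<rho> \<subseteq> {1, 2, 3}" "range \<rho>' \<subseteq> {1, 2}"
    and proper: "\<And>e. e \<in> E \<Longrightarrow> \<exists>x\<in>ends e \<inter> V. \<exists>y\<in>ends e \<inter> V. x \<noteq> y \<Longrightarrow>
      \<exists>x\<in>ends e \<inter> V. \<exists>y\<in>ends e \<inter> V. int_weight E ends \<rho> \<rho>' x \<noteq> int_weight E ends \<rho> \<rho>' y"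
    unfolding weighting_up_to_def by simp_all
  have \<rho>: "\<rho> e \<in> {1, 2, 3}" and \<rho>': "\<rho>' v \<in> {1, 2}" for e v using range by blast+
  \<comment> \<open>Nonnegativity makes the passage back to natural numbers lossless.\<close>
  have "\<rho> e \<ge> 0" "\<rho>' v \<ge> 0" for e v using \<rho>[of e] \<rho>'[of v] by auto
  then have int: "int (total_weight E ends (nat \<circ> \<rho>) (nat \<circ> \<rho>') v) = int_weight E ends \<rho> \<rho>' v" for v
    by (simp add: total_weight_def int_weight_def)
  have "properly_colors E ends (total_weight E ends (nat \<circ> \<rho>) (nat \<circ> \<rho>'))"
    unfolding properly_colors_def
  proof
    fix e assume e: "e \<in> E"
    then have "card (ends e) \<noteq> 0" "card (ends e) \<noteq> 1" using assms(2) by auto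
    then have "ends e \<noteq> {}" "\<nexists>x. ends e = {x}" by auto
    then have "\<exists>x\<in>ends e. \<exists>y\<in>ends e. x \<noteq> y" by blast
    then have "\<exists>x\<in>ends e \<inter> V. \<exists>y\<in>ends e \<inter> V. x \<noteq> y" using ends_subset[OF e] by blast
    from proper[OF e this] show "\<exists>x\<in>ends e. \<exists>y\<in>ends e.
        total_weight E ends (nat \<circ> \<rho>) (nat \<circ> \<rho>') x \<noteq> total_weight E ends (nat \<circ> \<rho>) (nat \<circ> \<rho>') y"
      by (metis int IntD1)
  qed
  moreover have "nat \<circ> \<rho> \<in> E \<rightarrow> {1, 2, 3}"
  proof
    fix e show "(nat \<circ> \<rho>) e \<in> {1, 2, 3}" using \<rho>[of e] by auto
  qed
  moreover have "nat \<circ> \<rho>' \<in> V \<rightarrow> {1, 2}"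
  proof
    fix v show "(nat \<circ> \<rho>') v \<in> {1, 2}" using \<rho>'[of v] by auto
  qed
  ultimately show ?thesis by blast
qed

end
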